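(* For each $k$ let $\lambda(x)=\frac{1+|x|^2}{2}$ for $x\in\mathbb{R}^k$. Let $A_1,\ldots,A_n$ be real $m\times m$ matrices. (1) The quadratic map $\varphi:\mathbb{R}^{m}\to(\mathbb{R}^{n},\lambda^{-2}\delta_{ij})\equiv(S^{n}\setminus\{N\},g_{can})$ from a Euclidean space (with its standard metric) into a sphere given by $\varphi(X)=(X^{t}A_{1}X,X^{t}A_{2}X,\ldots,X^{t}A_{n}X)$ is $\infty$-harmonic if and only if it is a constant map. (2) The quadratic map $\varphi:(\mathbb{R}^{m},\lambda^{-2}\delta_{ij})\equiv(S^{m}\setminus\{N\},g_{can})\to\mathbb{R}^{n}$ from a sphere into a Euclidean space (with its standard metric) given by $\varphi(X)=(X^{t}A_{1}X,X^{t}A_{2}X,\ldots,X^{t}A_{n}X)$ is $\infty$-harmonic if and only if it is a constant map.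
   Context: A smooth map $\varphi:(M,g)\to(N,h)$ between Riemannian manifolds is called $\infty$-harmonic if $\tfrac12\,{\rm d}\varphi({\rm grad}\,|{\rm d}\varphi|^2)=0$ on $M$, where $|{\rm d}\varphi|^2={\rm Trace}_g\,\varphi^*h$ is the energy density of $\varphi$ and the gradient is taken with respect to $g$. The $k$-sphere with its standard metric minus a point, $(S^{k}\setminus\{N\},g_{can})$, is identified (via stereographic projection) with $\mathbb{R}^k$ endowed with the metric $\left(\frac{1+|x|^2}{2}\right)^{-2}\delta_{ij}$. *)

theory Defs
  imports "HOL-Analysis.Analysis"
begin

text \<open>
  \<open>C\<^sup>k\<close> maps on the whole space. On a finite-dimensional domain, continuity of all
  directional derivatives \<open>x \<mapsto> df\<^sub>x(v)\<close> is the same as continuity of \<open>df\<close>.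
\<close>

primrec Ck_map :: "nat \<Rightarrow> ('a::real_normed_vector \<Rightarrow> 'b::real_normed_vector) \<Rightarrow> bool" where
  "Ck_map 0 f \<longleftrightarrow> continuous_on UNIV f"
| "Ck_map (Suc k) f \<longleftrightarrow> (\<forall>x. f differentiable (at x)) \<and>
     (\<forall>v. Ck_map k (\<lambda>x. frechet_derivative f (at x) v))"

definition smooth_map :: "('a::real_normed_vector \<Rightarrow> 'b::real_normed_vector) \<Rightarrow> bool" where
  "smooth_map f \<longleftrightarrow> (\<forall>k. Ck_map k f)"

text \<open>
  A Riemannian metric on \<open>\<real>\<^sup>k\<close> is given by its matrix \<open>g\<^sub>i\<^sub>j\<close> in the
  standard global chart, as a function of the base point. The operations below are the
  usual ones when \<open>g\<close> and \<open>h\<close> satisfy \<open>riemannian_metric\<close>, which is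
  proved below for both metrics of interest.
\<close>

type_synonym 'k metric = "real^'k \<Rightarrow> real^'k^'k"

definition riemannian_metric :: "('k::finite) metric \<Rightarrow> bool" where
  "riemannian_metric g \<longleftrightarrow> smooth_map g \<and>
     (\<forall>x. transpose (g x) = g x \<and> (\<forall>v. v \<noteq> 0 \<longrightarrow> v \<bullet> (g x *v v) > 0))"

definition pullback_metric ::
    "(real^'m \<Rightarrow> real^'n) \<Rightarrow> ('n::finite) metric \<Rightarrow> ('m::finite) metric" where
  "pullback_metric \<phi> h x =
     transpose (jacobian \<phi> (at x)) ** h (\<phi> x) ** jacobian \<phi> (at x)"

definition energy_density ::
    "('m::finite) metric \<Rightarrow> ('n::finite) metric \<Rightarrow> (real^'m \<Rightarrow> real^'n) \<Rightarrow> real^'m \<Rightarrow> real" where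
  "energy_density g h \<phi> x = trace (matrix_inv (g x) ** pullback_metric \<phi> h x)"

definition metric_grad :: "('m::finite) metric \<Rightarrow> (real^'m \<Rightarrow> real) \<Rightarrow> real^'m \<Rightarrow> real^'m" where
  "metric_grad g f x =
     matrix_inv (g x) *v (\<chi> i. frechet_derivative f (at x) (axis i 1))"

definition infinity_harmonic ::
    "('m::finite) metric \<Rightarrow> ('n::finite) metric \<Rightarrow> (real^'m \<Rightarrow> real^'n) \<Rightarrow> bool" where
  "infinity_harmonic g h \<phi> \<longleftrightarrow> smooth_map \<phi> \<and>
     (\<forall>x. (1/2) *\<^sub>R frechet_derivative \<phi> (at x) (metric_grad g (energy_density g h \<phi>) x) = 0)"

definition flat_metric :: "('k::finite) metric" where
  "flat_metric x = mat 1"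

definition stereo_lambda :: "real^'k \<Rightarrow> real" where
  "stereo_lambda x = (1 + (norm x)\<^sup>2) / 2"

text \<open>
  The standard metric of \<open>S\<^sup>k\<close> minus a point, read in the stereographic chart.
\<close>

definition sphere_metric :: "('k::finite) metric" where
  "sphere_metric x = mat (1 / (stereo_lambda x)\<^sup>2)"

definition quadratic_map :: "('n::finite \<Rightarrow> real^'m^'m) \<Rightarrow> real^'m \<Rightarrow> real^'n" where
  "quadratic_map A X = (\<chi> i. X \<bullet> (A i *v X))"

lemma Ck_map_SucD: "Ck_map (Suc k) f \<Longrightarrow> Ck_map k f"
proof (induction k arbitrary: f)
  case 0
  then show ?case
    by (auto intro!: differentiable_imp_continuous_on
        simp: differentiable_on_def)
next
  case (Suc k)
  then show ?case by (metis Ck_map.simps(2))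
qed

lemma Ck_map_const: "Ck_map k (\<lambda>x. c)"
  by (induction k arbitrary: c) auto

lemma Ck_map_bounded_linear: "bounded_linear f \<Longrightarrow> Ck_map k f"
proof (cases k)
  case 0
  assume "bounded_linear f"
  with 0 show ?thesis by (simp add: linear_continuous_on)
next
  case (Suc j)
  assume f: "bounded_linear f"
  then have d: "(f has_derivative f) (at x)" for x
    by (rule bounded_linear_imp_has_derivative)
  then have "frechet_derivative f (at x) = f" for x
    using frechet_derivative_at by metis
  with Suc d show ?thesis
    by (auto simp: Ck_map_const differentiable_def)
qed

lemma Ck_map_add: "Ck_map k f \<Longrightarrow> Ck_map k g \<Longrightarrow> Ck_map k (\<lambda>x. f x + g x)"
proof (induction k arbitrary: f g)
  case 0
  then show ?case by (auto intro: continuous_on_add)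
next
  case (Suc k)
  have d: "((\<lambda>x. f x + g x) has_derivative
      (\<lambda>v. frechet_derivative f (at x) v + frechet_derivative g (at x) v)) (at x)" for x
    using Suc.prems by (intro has_derivative_add) (auto simp: frechet_derivative_works)
  have e: "frechet_derivative (\<lambda>x. f x + g x) (at x) v =
      frechet_derivative f (at x) v + frechet_derivative g (at x) v" for x v
    using frechet_derivative_at[OF d] by metis
  show ?case
    using Suc d by (auto simp: e differentiable_def)
qed

lemma (in bounded_bilinear) Ck_map_prod:
  "Ck_map k f \<Longrightarrow> Ck_map k g \<Longrightarrow> Ck_map k (\<lambda>x. prod (f x) (g x))"
proof (induction k arbitrary: f g)
  case 0
  then show ?case by (auto intro: continuous_on)
next
  case (Suc k)
  have d: "((\<lambda>x. prod (f x) (g x)) has_derivative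
      (\<lambda>v. prod (f x) (frechet_derivative g (at x) v)
         + prod (frechet_derivative f (at x) v) (g x))) (at x)" for x
    using Suc.prems by (intro FDERIV) (auto simp: frechet_derivative_works)
  have e: "frechet_derivative (\<lambda>x. prod (f x) (g x)) (at x) v =
      prod (f x) (frechet_derivative g (at x) v)
         + prod (frechet_derivative f (at x) v) (g x)" for x v
    using frechet_derivative_at[OF d] by metis
  show ?case
    using Suc.prems Suc.IH Ck_map_SucD[OF Suc.prems(1)] Ck_map_SucD[OF Suc.prems(2)] d
    by (auto simp: e differentiable_def intro!: Ck_map_add)
qed

lemma Ck_map_inverse:
  fixes f :: "'a::real_normed_vector \<Rightarrow> real"
  assumes nz: "\<And>x. f x \<noteq> 0"
  shows "Ck_map k f \<Longrightarrow> Ck_map k (\<lambda>x. inverse (f x))"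
proof (induction k)
  case 0
  then show ?case using nz by (auto intro: continuous_on_inverse)
next
  case (Suc k)
  have d: "((\<lambda>x. inverse (f x)) has_derivative
      (\<lambda>v. (- 1) * (inverse (f x) * frechet_derivative f (at x) v * inverse (f x)))) (at x)" for x
  proof -
    have "(f has_derivative frechet_derivative f (at x)) (at x)"
      using Suc.prems by (simp add: frechet_derivative_works)
    from Deriv.has_derivative_inverse[OF nz this] show ?thesis by simp
  qed
  have e: "frechet_derivative (\<lambda>x. inverse (f x)) (at x) v =
      (- 1) * (inverse (f x) * frechet_derivative f (at x) v * inverse (f x))" for x v
    using frechet_derivative_at[OF d] by metis
  have "Ck_map k (\<lambda>x. inverse (f x))" "Ck_map k (\<lambda>x. frechet_derivative f (at x) v)" for v
    using Suc.IH Ck_map_SucD[OF Suc.prems] Suc.prems by auto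
  then have "Ck_map k (\<lambda>x. frechet_derivative (\<lambda>x. inverse (f x)) (at x) v)" for v
    unfolding e
    by (intro bounded_bilinear.Ck_map_prod[OF bounded_bilinear_mult] Ck_map_const)
  with d show ?case by (auto simp: differentiable_def)
qed

lemma mat_eq_scaleR: "(mat c :: real^'k^'k) = c *\<^sub>R mat 1"
  by (simp add: mat_def vec_eq_iff)

lemma mat_mult_vec: "(mat c :: real^'k^'k) *v v = c *\<^sub>R v"
  unfolding mat_eq_scaleR[of c] by (simp flip: scaleR_matrix_vector_assoc)

lemma stereo_lambda_pos: "stereo_lambda x > 0"
  unfolding stereo_lambda_def by (simp add: add_pos_nonneg)

lemma stereo_lambda_nonzero [simp]: "stereo_lambda x \<noteq> 0"
  using stereo_lambda_pos[of x] by simp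

lemma riemannian_metric_flat: "riemannian_metric flat_metric"
  unfolding riemannian_metric_def smooth_map_def flat_metric_def
  by (auto simp: Ck_map_const)

lemma riemannian_metric_sphere: "riemannian_metric (sphere_metric :: 'k::finite metric)"
proof -
  have "Ck_map k (stereo_lambda :: real^'k \<Rightarrow> real)" for k
  proof -
    have "stereo_lambda = (\<lambda>x::real^'k. 1/2 + (1/2) * (x \<bullet> x))"
      by (auto simp: stereo_lambda_def power2_norm_eq_inner field_simps)
    moreover have "Ck_map k (\<lambda>x::real^'k. 1/2 + (1/2) * (x \<bullet> x))"
      by (intro Ck_map_add Ck_map_const
          bounded_bilinear.Ck_map_prod[OF bounded_bilinear_mult]
          bounded_bilinear.Ck_map_prod[OF bounded_bilinear_inner]
          Ck_map_bounded_linear bounded_linear_ident)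
    ultimately show ?thesis by simp
  qed
  then have i: "Ck_map k (\<lambda>x::real^'k. inverse (stereo_lambda x))" for k
    by (intro Ck_map_inverse) simp_all
  have "(sphere_metric :: 'k metric) =
      (\<lambda>x. (inverse (stereo_lambda x) * inverse (stereo_lambda x)) *\<^sub>R mat 1)"
    unfolding sphere_metric_def
    by (subst mat_eq_scaleR) (auto simp: power2_eq_square field_simps)
  moreover have "Ck_map k (\<lambda>x::real^'k.
      (inverse (stereo_lambda x) * inverse (stereo_lambda x)) *\<^sub>R (mat 1 :: real^'k^'k))" for k
    by (intro i Ck_map_const
        bounded_bilinear.Ck_map_prod[OF bounded_bilinear_mult]
        bounded_bilinear.Ck_map_prod[OF bounded_bilinear_scaleR])
  ultimately have "smooth_map (sphere_metric :: 'k metric)"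
    unfolding smooth_map_def by simp
  moreover have "v \<bullet> (sphere_metric x *v v) > 0" if "v \<noteq> 0" for x v :: "real^'k"
    using that stereo_lambda_pos[of x] by (simp add: sphere_metric_def mat_mult_vec)
  ultimately show ?thesis
    unfolding riemannian_metric_def by (auto simp: sphere_metric_def)
qed

text \<open>
  The chart: the inverse stereographic projection from the north pole \<open>(0, 1)\<close>
  of the unit sphere in \<open>\<real>\<^sup>k \<times> \<real>\<close> is an isometry for
  \<open>sphere_metric\<close>.
\<close>

definition inv_stereographic :: "real^'k \<Rightarrow> (real^('k::finite)) \<times> real" where
  "inv_stereographic x = (inverse (stereo_lambda x) *\<^sub>R x, 1 - inverse (stereo_lambda x))"

lemma bij_inv_stereographic:
  "bij_betw (inv_stereographic :: real^'k::finite \<Rightarrow> _) UNIV (sphere 0 1 - {(0, 1)})"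
proof (rule bij_betw_byWitness[where f' = "\<lambda>(y, t). inverse (1 - t) *\<^sub>R y"])
  show "\<forall>x\<in>UNIV. (case inv_stereographic x of (y, t) \<Rightarrow> inverse (1 - t) *\<^sub>R y) = (x :: real^'k)"
    by (simp add: inv_stereographic_def)
  show "\<forall>p\<in>sphere 0 1 - {(0, 1)}.
      inv_stereographic (case p of (y, t) \<Rightarrow> inverse (1 - t) *\<^sub>R (y :: real^'k)) = p"
  proof
    fix p :: "(real^'k) \<times> real"
    assume p: "p \<in> sphere 0 1 - {(0, 1)}"
    obtain y t where yt: "p = (y, t)" by (cases p)
    have s: "(y, t) \<in> sphere 0 1" and ne: "(y, t) \<noteq> (0, 1)"
      using p yt by auto
    have n: "(norm y)\<^sup>2 + t\<^sup>2 = 1"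
      using s by (simp add: norm_prod_def real_sqrt_eq_1_iff)
    have t: "t \<noteq> 1" using n ne by auto
    have "(norm (inverse (1 - t) *\<^sub>R y))\<^sup>2 = (1 - t\<^sup>2) / (1 - t)\<^sup>2"
      using n by (simp add: power_mult_distrib power_divide divide_simps)
    also have "\<dots> = (1 + t) / (1 - t)"
      using t by (simp add: divide_simps) (simp add: power2_eq_square algebra_simps)
    finally have "stereo_lambda (inverse (1 - t) *\<^sub>R y) = (1 + (1 + t) / (1 - t)) / 2"
      by (simp only: stereo_lambda_def)
    also have "\<dots> = inverse (1 - t)"
      using t by (simp add: divide_simps)
    finally have "stereo_lambda (inverse (1 - t) *\<^sub>R y) = inverse (1 - t)" .
    then show "inv_stereographic (case p of (y, t) \<Rightarrow> inverse (1 - t) *\<^sub>R y) = p"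
      using t by (simp add: inv_stereographic_def yt)
  qed
  show "inv_stereographic ` (UNIV :: (real^'k) set) \<subseteq> sphere 0 1 - {(0, 1)}"
  proof (intro image_subsetI DiffI)
    fix x :: "real^'k"
    define l where "l = stereo_lambda x"
    have l: "l > 0" "(norm x)\<^sup>2 = 2 * l - 1"
      unfolding l_def by (rule stereo_lambda_pos) (simp add: stereo_lambda_def field_simps)
    have "(norm (inv_stereographic x))\<^sup>2 = (inverse l)\<^sup>2 * (norm x)\<^sup>2 + (1 - inverse l)\<^sup>2"
      using l(1) by (simp add: norm_prod_def inv_stereographic_def power_mult_distrib flip: l_def)
    also have "\<dots> = 1"
      unfolding l(2) using l(1) by (simp add: field_simps power2_eq_square)
    finally show "inv_stereographic x \<in> sphere 0 1"
      by (simp add: power2_eq_1_iff) (smt (verit) norm_ge_zero)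
    show "inv_stereographic x \<notin> {(0, 1)}"
      using l(1) by (simp add: inv_stereographic_def flip: l_def)
  qed
qed simp

lemma inv_stereographic_isometry:
  fixes x v w :: "real^'k::finite"
  defines "D \<equiv> frechet_derivative inv_stereographic (at x)"
  shows "inv_stereographic differentiable (at x)"
    and "D v \<bullet> D w = v \<bullet> (sphere_metric x *v w)"
proof -
  define l where "l = stereo_lambda x"
  define E where "E v = (inverse l *\<^sub>R v - (inverse l ^ 2 * (x \<bullet> v)) *\<^sub>R x, inverse l ^ 2 * (x \<bullet> v))"
    for v :: "real^'k"
  have l: "l > 0" "x \<bullet> x = 2 * l - 1"
    unfolding l_def by (rule stereo_lambda_pos) (simp add: stereo_lambda_def power2_norm_eq_inner field_simps)
  have s: "(stereo_lambda has_derivative (\<lambda>v. x \<bullet> v)) (at x)"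
    unfolding stereo_lambda_def[abs_def] power2_norm_eq_inner
    by (auto intro!: derivative_eq_intros simp: inner_commute)
  have i: "((\<lambda>y. inverse (stereo_lambda y)) has_derivative (\<lambda>v. - (inverse l ^ 2 * (x \<bullet> v)))) (at x)"
    using Deriv.has_derivative_inverse[OF _ s] l(1)
    by (simp add: l_def power2_eq_square mult_ac)
  have E: "(inv_stereographic has_derivative E) (at x)"
    unfolding inv_stereographic_def[abs_def] E_def[abs_def]
    by (rule has_derivative_eq_rhs, (rule has_derivative_Pair has_derivative_scaleR
        has_derivative_diff has_derivative_const has_derivative_ident i)+)
      (auto simp: fun_eq_iff l_def)
  then show "inv_stereographic differentiable (at x)" by (auto simp: differentiable_def)
  have D: "D = E" unfolding D_def using frechet_derivative_at[OF E] by simp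
  have "v \<bullet> x = x \<bullet> v" by (rule inner_commute)
  then have "E v \<bullet> E w = inverse l ^ 2 * (v \<bullet> w)
      - 2 * inverse l ^ 3 * (x \<bullet> v) * (x \<bullet> w)
      + inverse l ^ 4 * (x \<bullet> v) * (x \<bullet> w) * (1 + x \<bullet> x)"
    unfolding E_def
    by (simp add: inner_diff_left inner_diff_right power2_eq_square power3_eq_cube
        power4_eq_xxxx algebra_simps)
  also have "1 + x \<bullet> x = 2 * l" using l(2) by simp
  also have "inverse l ^ 4 * (x \<bullet> v) * (x \<bullet> w) * (2 * l) =
      2 * inverse l ^ 3 * (x \<bullet> v) * (x \<bullet> w)"
    using l(1) by (simp add: power3_eq_cube power4_eq_xxxx)
  finally have "E v \<bullet> E w = inverse l ^ 2 * (v \<bullet> w)" by simp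
  then show "D v \<bullet> D w = v \<bullet> (sphere_metric x *v w)"
    unfolding D by (simp add: sphere_metric_def mat_mult_vec l_def divide_inverse power_inverse)
qed

end

theory Submission
  imports Defs
begin

text \<open>
  With \<open>G\<^sub>i = grad \<phi>\<^sub>i\<close> and \<open>E = \<Sum>\<^sub>i |G\<^sub>i|\<^sup>2\<close>, both equations say that the derivative of
  the energy density (\<open>E / \<lambda>(\<phi>)\<^sup>2\<close> resp. \<open>\<lambda>\<^sup>2 E\<close>) vanishes along every \<open>G\<^sub>i\<close>. After clearing
  powers of \<open>\<lambda>\<close> these are polynomial identities with homogeneous parts of two different
  degrees (2 and 6 resp. 2 and 4), which must vanish separately; comparing \<open>x\<close> with \<open>2x\<close>
  separates them. The lower part gives \<open>dE(G\<^sub>i) = 0\<close>, the higher one then gives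
  \<open>E |\<Sum>\<^sub>j \<phi>\<^sub>j G\<^sub>j|\<^sup>2 = 0\<close> resp. \<open>E \<phi>\<^sub>i = 0\<close>. Where \<open>E = 0\<close>, all \<open>G\<^sub>i\<close> vanish, and Euler's
  relation \<open>G\<^sub>i \<bullet> x = 2 \<phi>\<^sub>i\<close> yields \<open>\<phi> = 0\<close> in every case.
\<close>

lemma mat_mult_matrix: "(mat c :: real^'n::finite^'n) ** M = c *\<^sub>R M"
  by (subst mat_eq_scaleR) (simp flip: scalar_matrix_assoc)

lemma matrix_inv_mat:
  assumes "c \<noteq> 0"
  shows "matrix_inv (mat c :: real^'n::finite^'n) = mat (inverse c)"
proof -
  have "mat a ** mat b = (mat (a * b) :: real^'n^'n)" for a b :: real
    unfolding mat_mult_matrix by (simp add: mat_def vec_eq_iff)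
  then have inv: "mat c ** mat (inverse c) = (mat 1 :: real^'n^'n)"
      "mat (inverse c) ** mat c = (mat 1 :: real^'n^'n)"
    using assms by simp_all
  \<comment> \<open>\<open>matrix_inv\<close> is a choice among two-sided inverses: the pair above
    shows that one exists, and uniqueness of inverses then identifies the chosen one.\<close>
  then have "matrix_inv (mat c :: real^'n^'n) ** mat c = mat 1"
    unfolding matrix_inv_def by (metis (mono_tags, lifting) someI)
  then show ?thesis
    using inv(1) by (metis matrix_mul_assoc matrix_mul_lid matrix_mul_rid)
qed

lemma trace_transpose_mult_self:
  fixes J :: "real^'m::finite^'n::finite"
  shows "trace (transpose J ** J) = (\<Sum>i\<in>UNIV. J $ i \<bullet> J $ i)"
proof -
  have "trace (transpose J ** J) = (\<Sum>k\<in>UNIV. \<Sum>i\<in>UNIV. J $ i $ k * J $ i $ k)"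
    by (simp add: trace_def matrix_matrix_mult_def transpose_def)
  also have "\<dots> = (\<Sum>i\<in>UNIV. J $ i \<bullet> J $ i)"
    by (subst sum.swap) (simp add: inner_vec_def)
  finally show ?thesis .
qed

text \<open>The rows of the Jacobian are the gradients \<open>G i\<close>, and scalar metrics factor
  out of the trace: the target contributes \<open>b\<close>, the inverse of the domain metric
  \<open>1 / a\<close>. The scalars are fixed only at \<open>x\<close> and \<open>f x\<close>, since
  conformal factors vary with the point.\<close>

lemma energy_density_conformal:
  fixes f :: "real^'m::finite \<Rightarrow> real^'n::finite"
  assumes "(f has_derivative (\<lambda>v. \<chi> i. G i \<bullet> v)) (at x)"
    and "g x = mat a" "h (f x) = mat b" "a \<noteq> 0"
  shows "energy_density g h f x = (b / a) * (\<Sum>i\<in>UNIV. G i \<bullet> G i)"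
proof -
  have J: "jacobian f (at x) = (\<chi> i. G i)"
    using frechet_derivative_at[OF assms(1), symmetric]
    by (simp add: jacobian_def matrix_def vec_eq_iff inner_axis)
  have "pullback_metric f h x = b *\<^sub>R (transpose (jacobian f (at x)) ** jacobian f (at x))"
    unfolding pullback_metric_def assms(3)
    by (subst mat_eq_scaleR) (simp add: matrix_scalar_ac scalar_matrix_assoc)
  then show ?thesis
    using assms(4) trace_transpose_mult_self[of "jacobian f (at x)"]
    unfolding energy_density_def assms(2) matrix_inv_mat[OF assms(4)] mat_mult_matrix
    by (simp add: J trace_def sum_distrib_left[symmetric] divide_inverse)
qed

text \<open>At \<open>x\<close> the metric gradient is the Euclidean one divided by
  \<open>a\<close>, so component \<open>i\<close> of the equation is a nonzero multiple of the
  derivative of the energy density along \<open>G i\<close>.\<close>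

lemma infinity_harmonic_conformalD:
  fixes f :: "real^'m::finite \<Rightarrow> real^'n::finite"
  assumes "infinity_harmonic g h f"
    and df: "(f has_derivative (\<lambda>v. \<chi> i. G i \<bullet> v)) (at x)"
    and g: "g x = mat a" "a \<noteq> 0"
    and de: "(energy_density g h f has_derivative D) (at x)"
  shows "D (G i) = 0"
proof -
  let ?w = "\<chi> j. D (axis j 1)"
  have fd: "frechet_derivative f (at x) = (\<lambda>v. \<chi> i. G i \<bullet> v)"
    "frechet_derivative (energy_density g h f) (at x) = D"
    using frechet_derivative_at[OF df] frechet_derivative_at[OF de] by simp_all
  have "frechet_derivative f (at x) (metric_grad g (energy_density g h f) x) = 0"
    using assms(1) by (auto simp: infinity_harmonic_def)
  then have "G i \<bullet> ?w = 0"
    using g(2) by (simp add: fd metric_grad_def g(1) matrix_inv_mat mat_mult_vec vec_eq_iff)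
  moreover have "D (G i) = G i \<bullet> ?w"
  proof -
    have D: "linear D" using de by (rule has_derivative_linear)
    have "D (G i) = D (\<Sum>j\<in>UNIV. G i $ j *\<^sub>R axis j 1)"
      using basis_expansion[of "G i"] by (simp add: scalar_mult_eq_scaleR)
    also have "\<dots> = G i \<bullet> ?w"
      by (simp add: linear_sum[OF D] linear_cmul[OF D] inner_vec_def)
    finally show ?thesis .
  qed
  ultimately show ?thesis by simp
qed

lemma infinity_harmonic_constant:
  assumes "f constant_on UNIV"
  shows "infinity_harmonic g h f"
proof -
  obtain c where "f = (\<lambda>x. c)" using assms by (auto simp: constant_on_def)
  then show ?thesis by (simp add: infinity_harmonic_def smooth_map_def Ck_map_const)
qed

text \<open>The Euclidean gradient of the quadratic form of \<open>B\<close>; both summands appear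
  because \<open>B\<close> may be non-symmetric.\<close>

definition quad_grad :: "real^'m^'m \<Rightarrow> real^'m::finite \<Rightarrow> real^'m" where
  "quad_grad B x = transpose B *v x + B *v x"

lemma quad_grad_scaleR: "quad_grad B (t *\<^sub>R x) = t *\<^sub>R quad_grad B x"
  by (simp add: quad_grad_def matrix_vector_mult_scaleR scaleR_add_right)

lemma bounded_linear_quad_grad: "bounded_linear (quad_grad B)"
  unfolding quad_grad_def[abs_def]
  by (intro bounded_linear_add matrix_vector_mul_bounded_linear)

lemma inner_quad_grad: "quad_grad B x \<bullet> v = x \<bullet> (B *v v) + v \<bullet> (B *v x)"
  by (simp add: quad_grad_def inner_add_left dot_lmul_matrix inner_commute[of v])

lemma quad_grad_euler: "quad_grad B x \<bullet> x = 2 * (x \<bullet> (B *v x))"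
  by (simp add: inner_quad_grad)

lemma has_derivative_quadratic_map:
  fixes A :: "'n::finite \<Rightarrow> real^('m::finite)^'m"
  shows "(quadratic_map A has_derivative (\<lambda>v. \<chi> i. quad_grad (A i) x \<bullet> v)) (at x)"
proof -
  have "((\<lambda>X. X \<bullet> (B *v X)) has_derivative (\<lambda>v. quad_grad B x \<bullet> v)) (at x)" for B :: "real^'m^'m"
  proof (rule has_derivative_eq_rhs)
    show "((\<lambda>X. X \<bullet> (B *v X)) has_derivative (\<lambda>v. x \<bullet> (B *v v) + v \<bullet> (B *v x))) (at x)"
      by (intro has_derivative_inner has_derivative_ident
          bounded_linear_imp_has_derivative matrix_vector_mul_bounded_linear)
    show "(\<lambda>v. x \<bullet> (B *v v) + v \<bullet> (B *v x)) = (\<lambda>v. quad_grad B x \<bullet> v)"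
      by (simp add: inner_quad_grad)
  qed
  then show ?thesis
    unfolding quadratic_map_def[abs_def] has_derivative_componentwise_within[of "\<lambda>x. \<chi> i. _ x i"]
    by (auto simp: Basis_vec_def inner_axis)
qed

lemma quadratic_map_scaleR: "quadratic_map A (t *\<^sub>R x) = t\<^sup>2 *\<^sub>R quadratic_map A x"
  by (simp add: quadratic_map_def vec_eq_iff matrix_vector_mult_scaleR power2_eq_square)

text \<open>The energy density for Euclidean metrics on both sides; each sphere metric changes it
  only by a power of \<open>stereo_lambda\<close>.\<close>

definition flat_energy :: "('n::finite \<Rightarrow> real^'m^'m) \<Rightarrow> real^'m::finite \<Rightarrow> real" where
  "flat_energy A x = (\<Sum>i\<in>UNIV. quad_grad (A i) x \<bullet> quad_grad (A i) x)"

definition flat_energy_deriv :: "('n::finite \<Rightarrow> real^'m^'m) \<Rightarrow> real^'m::finite \<Rightarrow> real^'m \<Rightarrow> real" where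
  "flat_energy_deriv A x v = (\<Sum>i\<in>UNIV. 2 * (quad_grad (A i) x \<bullet> quad_grad (A i) v))"

lemma flat_energy_scaleR: "flat_energy A (t *\<^sub>R x) = t\<^sup>2 * flat_energy A x"
  by (simp add: flat_energy_def quad_grad_scaleR sum_distrib_left power2_eq_square mult_ac)

text \<open>Base point and direction scale separately because the direction used later,
  \<open>quad_grad (A i) x\<close>, itself depends linearly on \<open>x\<close>.\<close>

lemma flat_energy_deriv_scaleR:
  "flat_energy_deriv A (t *\<^sub>R x) (s *\<^sub>R v) = t * s * flat_energy_deriv A x v"
  by (simp add: flat_energy_deriv_def quad_grad_scaleR sum_distrib_left mult_ac)

lemma has_derivative_flat_energy:
  "(flat_energy A has_derivative flat_energy_deriv A x) (at x)"
  unfolding flat_energy_def[abs_def] flat_energy_deriv_def[abs_def]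
proof (rule has_derivative_sum)
  fix i
  have d: "(quad_grad (A i) has_derivative quad_grad (A i)) (at x)"
    by (intro bounded_linear_imp_has_derivative bounded_linear_quad_grad)
  show "((\<lambda>x. quad_grad (A i) x \<bullet> quad_grad (A i) x) has_derivative
      (\<lambda>v. 2 * (quad_grad (A i) x \<bullet> quad_grad (A i) v))) (at x)"
    by (rule has_derivative_eq_rhs[OF has_derivative_inner[OF d d]])
      (simp add: fun_eq_iff inner_commute)
qed

lemma flat_energy_eq_0_iff: "flat_energy A x = 0 \<longleftrightarrow> (\<forall>i. quad_grad (A i) x = 0)"
  by (simp add: flat_energy_def sum_nonneg_eq_0_iff)

lemma quadratic_map_eq_0_if_flat_energy:
  assumes "flat_energy A x = 0"
  shows "quadratic_map A x = 0"
proof -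
  have "x \<bullet> (A i *v x) = 0" for i
    using assms quad_grad_euler[of "A i" x] by (simp add: flat_energy_eq_0_iff)
  then show ?thesis by (simp add: quadratic_map_def vec_eq_iff)
qed

lemma has_derivative_stereo_lambda: "(stereo_lambda has_derivative (\<lambda>v. x \<bullet> v)) (at x)"
  unfolding stereo_lambda_def[abs_def] power2_norm_eq_inner
  by (auto intro!: derivative_eq_intros simp: inner_commute)

lemma infinity_harmonic_into_sphere_imp_zero:
  fixes A :: "'n::finite \<Rightarrow> real^('m::finite)^'m"
  assumes ih: "infinity_harmonic flat_metric sphere_metric (quadratic_map A)"
  shows "quadratic_map A x = 0"
proof -
  let ?\<phi> = "quadratic_map A"
  let ?G = "\<lambda>x i. quad_grad (A i) x"
  define a where "a x i = flat_energy_deriv A x (?G x i)" for x i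
  \<comment> \<open>\<open>w x\<close> is the gradient of \<open>stereo_lambda\<close> composed with
    the map, that is, of half its squared norm.\<close>
  define w where "w x = (\<Sum>j\<in>UNIV. ?\<phi> x $ j *\<^sub>R ?G x j)" for x
  have key: "(1 + ?\<phi> x \<bullet> ?\<phi> x) * a x i = 4 * flat_energy A x * (w x \<bullet> ?G x i)" for x i
  proof -
    let ?l = "\<lambda>x. stereo_lambda (?\<phi> x)"
    have e: "energy_density flat_metric sphere_metric ?\<phi> = (\<lambda>x. flat_energy A x / (?l x)\<^sup>2)"
      by (rule ext, subst energy_density_conformal[OF has_derivative_quadratic_map
            flat_metric_def sphere_metric_def]) (simp_all add: flat_energy_def)
    have dl: "(?l has_derivative (\<lambda>v. w x \<bullet> v)) (at x)"
      by (rule has_derivative_eq_rhs[OF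
            has_derivative_compose[OF has_derivative_quadratic_map has_derivative_stereo_lambda]])
        (simp add: fun_eq_iff inner_vec_def[of "?\<phi> x"] w_def inner_sum_left)
    define l where "l = ?l x"
    have l0: "l \<noteq> 0" by (simp add: l_def)
    let ?D = "\<lambda>v. (flat_energy_deriv A x v * l\<^sup>2 - flat_energy A x * (2 * l * (w x \<bullet> v))) / l ^ 4"
    have d2: "((\<lambda>x. (?l x)\<^sup>2) has_derivative (\<lambda>v. 2 * l * (w x \<bullet> v))) (at x)"
      by (rule has_derivative_eq_rhs[OF has_derivative_power[OF dl]]) (simp add: l_def fun_eq_iff)
    have "(energy_density flat_metric sphere_metric ?\<phi> has_derivative ?D) (at x)"
      unfolding e
      by (rule has_derivative_eq_rhs[OF has_derivative_divide'[OF has_derivative_flat_energy d2]])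
        (simp_all add: l_def fun_eq_iff power4_eq_xxxx power2_eq_square)
    from infinity_harmonic_conformalD[OF ih has_derivative_quadratic_map _ _ this, of 1 i]
    have "a x i * l\<^sup>2 = flat_energy A x * (2 * l * (w x \<bullet> ?G x i))"
      using l0 by (simp add: flat_metric_def a_def)
    then have "a x i * l = flat_energy A x * (2 * (w x \<bullet> ?G x i))"
      using l0 by (simp add: power2_eq_square)
    moreover have "l = (1 + ?\<phi> x \<bullet> ?\<phi> x) / 2"
      by (simp add: l_def stereo_lambda_def power2_norm_eq_inner)
    ultimately show ?thesis by (simp add: field_simps)
  qed
  have ew: "flat_energy A x * (w x \<bullet> ?G x i) = 0" for i
  proof -
    have w2: "w (2 *\<^sub>R x) = 8 *\<^sub>R w x"
      by (simp add: w_def quadratic_map_scaleR quad_grad_scaleR scaleR_sum_right)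
    have a2: "a (2 *\<^sub>R x) i = 4 * a x i"
      by (simp add: a_def quad_grad_scaleR flat_energy_deriv_scaleR)
    \<comment> \<open>The factor 256 is 4 from the identity, times 4 from the energy, 8 from
      \<open>w\<close> and 2 from the gradient.\<close>
    have "(1 + 16 * (?\<phi> x \<bullet> ?\<phi> x)) * (4 * a x i) = 256 * (flat_energy A x * (w x \<bullet> ?G x i))"
      using key[of "2 *\<^sub>R x" i]
      by (simp add: w2 a2 quadratic_map_scaleR quad_grad_scaleR flat_energy_scaleR)
    \<comment> \<open>Subtracting this from 64 times the identity at \<open>x\<close> cancels the
      degree 6 terms and leaves \<open>60 * a x i = 0\<close>.\<close>
    then have "a x i = 0" using key[of x i] by (simp add: algebra_simps)
    then show ?thesis using key[of x i] by simp
  qed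
  have "w x = 0" if "flat_energy A x \<noteq> 0"
  proof -
    \<comment> \<open>\<open>w x\<close> is a combination of the gradients and orthogonal to each of
      them, hence to itself.\<close>
    have "w x \<bullet> w x = (\<Sum>j\<in>UNIV. ?\<phi> x $ j * (w x \<bullet> ?G x j))"
      by (subst (2) w_def) (simp add: inner_sum_right)
    then show ?thesis using ew that by simp
  qed
  moreover have "w x \<bullet> x = 2 * (?\<phi> x \<bullet> ?\<phi> x)"
    by (simp add: w_def inner_sum_left quad_grad_euler inner_vec_def[of "?\<phi> x"] sum_distrib_left)
      (simp add: quadratic_map_def mult_ac)
  ultimately show ?thesis
    using quadratic_map_eq_0_if_flat_energy[of A x] by force
qed

lemma infinity_harmonic_from_sphere_imp_zero:
  fixes A :: "'n::finite \<Rightarrow> real^('m::finite)^'m"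
  assumes ih: "infinity_harmonic sphere_metric flat_metric (quadratic_map A)"
  shows "quadratic_map A x = 0"
proof -
  let ?\<phi> = "quadratic_map A"
  let ?G = "\<lambda>x i. quad_grad (A i) x"
  define a where "a x i = flat_energy_deriv A x (?G x i)" for x i
  have key: "(1 + x \<bullet> x) * a x i + 8 * flat_energy A x * ?\<phi> x $ i = 0" for x i
  proof -
    have e: "energy_density sphere_metric flat_metric ?\<phi> =
        (\<lambda>x. (stereo_lambda x)\<^sup>2 * flat_energy A x)"
      by (rule ext, subst energy_density_conformal[OF has_derivative_quadratic_map
            sphere_metric_def flat_metric_def]) (simp_all add: flat_energy_def)
    define l where "l = stereo_lambda x"
    have l0: "l \<noteq> 0" by (simp add: l_def)
    let ?D = "\<lambda>v. l\<^sup>2 * flat_energy_deriv A x v + 2 * l * (x \<bullet> v) * flat_energy A x"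
    have d2: "((\<lambda>x. (stereo_lambda x)\<^sup>2) has_derivative (\<lambda>v. 2 * l * (x \<bullet> v))) (at x)"
      by (rule has_derivative_eq_rhs[OF has_derivative_power[OF has_derivative_stereo_lambda]])
        (simp add: l_def fun_eq_iff)
    have "(energy_density sphere_metric flat_metric ?\<phi> has_derivative ?D) (at x)"
      unfolding e
      by (rule has_derivative_eq_rhs[OF has_derivative_mult[OF d2 has_derivative_flat_energy]])
        (simp add: l_def)
    from infinity_harmonic_conformalD[OF ih has_derivative_quadratic_map _ _ this, of "1 / l\<^sup>2" i]
    have "l * (l * a x i + 2 * (?G x i \<bullet> x) * flat_energy A x) = 0"
      using l0
      by (simp add: sphere_metric_def a_def l_def inner_commute power2_eq_square algebra_simps)
    \<comment> \<open>One factor \<open>l\<close> cancels, and Euler's relation replaces the radial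
      derivative by the component of the map.\<close>
    then have "l * a x i + 4 * ?\<phi> x $ i * flat_energy A x = 0"
      using l0 by (simp add: quad_grad_euler quadratic_map_def)
    moreover have "l = (1 + x \<bullet> x) / 2"
      by (simp add: l_def stereo_lambda_def power2_norm_eq_inner)
    ultimately show ?thesis by (simp add: field_simps)
  qed
  have "flat_energy A x * ?\<phi> x $ i = 0" for i
  proof -
    have a2: "a (2 *\<^sub>R x) i = 4 * a x i"
      by (simp add: a_def quad_grad_scaleR flat_energy_deriv_scaleR)
    have "(1 + 4 * (x \<bullet> x)) * (4 * a x i) + 128 * (flat_energy A x * ?\<phi> x $ i) = 0"
      using key[of "2 *\<^sub>R x" i]
      by (simp add: a2 quadratic_map_scaleR flat_energy_scaleR)
    \<comment> \<open>Here 16 times the identity at \<open>x\<close> matches the degree 4 terms; the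
      difference is \<open>12 * a x i = 0\<close>.\<close>
    then have "a x i = 0" using key[of x i] by (simp add: algebra_simps)
    then show ?thesis using key[of x i] by simp
  qed
  then show ?thesis
    using quadratic_map_eq_0_if_flat_energy[of A x] by (auto simp: vec_eq_iff)
qed

theorem theorem4p1:
  fixes A :: "'n::finite \<Rightarrow> real^('m::finite)^'m"
  shows "(infinity_harmonic flat_metric sphere_metric (quadratic_map A)
            \<longleftrightarrow> quadratic_map A constant_on UNIV)
       \<and> (infinity_harmonic sphere_metric flat_metric (quadratic_map A)
            \<longleftrightarrow> quadratic_map A constant_on UNIV)"
  \<comment> \<open>Harmonicity makes the map constant with value 0; conversely, the zero
    differential of a constant map kills every gradient.\<close>
  using infinity_harmonic_into_sphere_imp_zero infinity_harmonic_from_sphere_imp_zero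
    infinity_harmonic_constant
  unfolding constant_on_def by metis

end
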